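(* Let $v>0$ and let $(X_t)_{t\ge1}$ be random vectors in $\mathbb{R}^d$ with $\mathbb{E}[X_t\mid\mathcal{F}_{t-1}]=\mu$ and $\mathbb{E}[\|X_t\|^2\mid\mathcal{F}_{t-1}]\le v^2<\infty$ for all $t\ge1$. Suppose the vectors are also conditionally symmetric: for all $t\ge1$, conditionally on $\mathcal{F}_{t-1}$, $X_t-\mu$ and $-(X_t-\mu)$ have the same distribution. Then for any positive predictable sequence $(\lambda_t)_{t\ge1}$ and any $\alpha\in(0,1)$, with probability at least $1-\alpha$, for all $t\geq 1$ simultaneously, $$\left\|\frac{\sum_{i\leq t}\lambda_iX_i}{\sum_{i\leq t}\lambda_i}-\mu\right\|\leq\frac{\sum_{i\leq t}\lambda_i^2(\|X_i\|+v)^2+1/2+\log(1/\alpha)}{\sum_{i\leq t}\lambda_i}.$$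
   Context: $\mathcal{F}_t=\sigma(X_1,\dots,X_t)$ ($\mathcal{F}_0$ trivial); $(\lambda_t)$ is predictable if $\lambda_t$ is $\mathcal{F}_{t-1}$-measurable for every $t$. $\|\cdot\|$ is the Euclidean norm. *)

theory Defs
  imports "HOL-Probability.Probability"
begin

(* F_t = sigma(X_1, ..., X_t), as a sigma-algebra on space M.  It is generated by preimages rather
   than by a Sup of vimage_algebra's because the empty Sup would have empty carrier, whereas F_0
   must be the trivial sigma-algebra on space M.  Only space and sets matter. *)
definition natural_filtration ::
    "'a measure \<Rightarrow> (nat \<Rightarrow> 'a \<Rightarrow> 'b::topological_space) \<Rightarrow> nat \<Rightarrow> 'a measure" where
  "natural_filtration M X t =
     sigma (space M) (\<Union>i\<in>{1..t}. {X i -` A \<inter> space M | A. A \<in> sets borel})"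

(* Time starts at 1; values at index 0 are irrelevant. *)
definition predictable :: "(nat \<Rightarrow> 'a measure) \<Rightarrow> (nat \<Rightarrow> 'a \<Rightarrow> real) \<Rightarrow> bool" where
  "predictable F \<Lambda> \<longleftrightarrow> (\<forall>t\<ge>1. \<Lambda> t \<in> borel_measurable (F (t - 1)))"

(* Conditional expectation of a random vector, taken coordinatewise.  As for real_cond_exp, it is
   meaningful only for integrable Y. *)
definition vec_cond_exp ::
    "'a measure \<Rightarrow> 'a measure \<Rightarrow> ('a \<Rightarrow> real ^ 'd) \<Rightarrow> 'a \<Rightarrow> real ^ 'd" where
  "vec_cond_exp M F Y \<omega> = (\<chi> j. real_cond_exp M F (\<lambda>x. Y x $ j) \<omega>)"

(* P(A | F), a version of the conditional probability given a sub-sigma-algebra. *)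
definition subalgebra_prob :: "'a measure \<Rightarrow> 'a measure \<Rightarrow> 'a set \<Rightarrow> 'a \<Rightarrow> real" where
  "subalgebra_prob M F A = real_cond_exp M F (indicat_real A)"

(* Conditionally on F, the variables Y and Z have the same distribution:
   P(Y \<in> B | F) = P(Z \<in> B | F) almost surely, for every Borel set B. *)
definition cond_same_distr ::
    "'a measure \<Rightarrow> 'a measure \<Rightarrow> ('a \<Rightarrow> 'b::topological_space) \<Rightarrow> ('a \<Rightarrow> 'b) \<Rightarrow> bool" where
  "cond_same_distr M F Y Z \<longleftrightarrow>
     (\<forall>B\<in>sets borel. AE \<omega> in M.
        subalgebra_prob M F (Y -` B \<inter> space M) \<omega> = subalgebra_prob M F (Z -` B \<inter> space M) \<omega>)"

end

theory Submission
  imports Defs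
begin

text \<open>With \<open>Y\<^sub>i = X\<^sub>i - \<mu>\<close>, \<open>S\<^sub>t = \<Sum>i\<le>t. \<lambda>\<^sub>i Y\<^sub>i\<close> and \<open>C\<^sub>t = \<Sum>i\<le>t. \<lambda>\<^sub>i\<^sup>2 \<parallel>Y\<^sub>i\<parallel>\<^sup>2\<close>, the process
  \<open>cosh (sqrt 2 \<parallel>S\<^sub>t\<parallel>) exp (- C\<^sub>t)\<close> is a nonnegative supermartingale started at \<open>1\<close>. Indeed, by
  conditional symmetry the increment \<open>z = \<lambda>\<^sub>t Y\<^sub>t\<close> may be averaged with \<open>- z\<close>, and in an inner product
  space \<open>(cosh (k\<parallel>s + z\<parallel>) + cosh (k\<parallel>s - z\<parallel>)) / 2 \<le> cosh (k\<parallel>s\<parallel>) cosh (k\<parallel>z\<parallel>)\<close>, while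
  \<open>cosh (sqrt 2 \<parallel>z\<parallel>) \<le> exp (\<parallel>z\<parallel>\<^sup>2)\<close>. By Ville's inequality it stays below \<open>1 / \<alpha>\<close> at all times with
  probability at least \<open>1 - \<alpha>\<close>, and \<open>cosh (sqrt 2 x) \<ge> exp (x - 1 / 2)\<close> turns this into
  \<open>\<parallel>S\<^sub>t\<parallel> \<le> C\<^sub>t + 1 / 2 + ln (1 / \<alpha>)\<close>. Finally \<open>\<parallel>Y\<^sub>i\<parallel> \<le> \<parallel>X\<^sub>i\<parallel> + v\<close>, because the second moment bound
  forces \<open>\<parallel>\<mu>\<parallel> \<le> v\<close>.\<close>

section \<open>Elementary inequalities for \<open>cosh\<close>, scalar and in inner product
  spaces\<close>

text \<open>Only even indices contribute to the series of \<open>cosh\<close>. Writing it in powers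
  of \<open>x\<^sup>2\<close> makes it possible to compare values of \<open>cosh\<close> term by
  term through the squares of their arguments.\<close>

lemma cosh_sums_even:
  fixes x :: real
  shows "(\<lambda>m. (x\<^sup>2) ^ m / fact (2 * m)) sums cosh x"
proof -
  have "(\<lambda>m. if even (2 * m) then x ^ (2 * m) /\<^sub>R fact (2 * m) else 0) sums cosh x"
    by (subst sums_mono_reindex[where g = "\<lambda>m. 2 * m"])
      (use cosh_converges[of x] in \<open>auto simp: strict_mono_def elim!: evenE\<close>)
  then show ?thesis
    by (simp add: divide_inverse mult.commute flip: power_mult)
qed

text \<open>The even factors of \<open>fact (2 * m)\<close> multiply to
  \<open>2 ^ m * fact m\<close>, and its odd factors are all at least 1. This compares the series of
  \<open>cosh x\<close> with that of \<open>exp (x\<^sup>2 / 2)\<close>.\<close>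

lemma two_power_fact_le_fact_double: "2 ^ m * fact m \<le> (fact (2 * m) :: real)"
proof (induction m)
  case (Suc m)
  have "2 ^ Suc m * fact (Suc m) = 2 * (real m + 1) * (2 ^ m * fact m :: real)"
    by (simp add: algebra_simps)
  also have "\<dots> \<le> 2 * (real m + 1) * fact (2 * m)"
    using Suc by (intro mult_left_mono) auto
  also have "\<dots> \<le> (2 * real m + 1) * (2 * (real m + 1) * fact (2 * m))"
    using mult_right_mono[of 1 "2 * real m + 1" "2 * (real m + 1) * fact (2 * m)"] by simp
  also have "\<dots> = fact (2 * Suc m)"
    by (simp add: algebra_simps)
  finally show ?case .
qed simp

lemma cosh_le_exp_half_square:
  fixes x :: real
  shows "cosh x \<le> exp (x\<^sup>2 / 2)"
proof (rule sums_le[OF _ cosh_sums_even exp_converges])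
  fix m
  have "(x\<^sup>2) ^ m / fact (2 * m) \<le> (x\<^sup>2) ^ m / (2 ^ m * fact m)"
    by (intro divide_left_mono two_power_fact_le_fact_double) auto
  then show "(x\<^sup>2) ^ m / fact (2 * m) \<le> (x\<^sup>2 / 2) ^ m /\<^sub>R fact m"
    by (simp add: field_simps)
qed

lemma convex_on_power_nonneg: "convex_on {0::real..} (\<lambda>x. x ^ n)"
proof (cases "even n")
  case True
  then show ?thesis
    using convex_on_subset[OF convex_power_even] by blast
qed (simp add: convex_power_odd)

text \<open>The points \<open>u\<close> and \<open>w\<close> are mirror images in the midpoint of
  \<open>a\<close> and \<open>b\<close>, so their convex weights are \<open>1 - t, t\<close> and
  \<open>t, 1 - t\<close>. Adding the two convexity bounds cancels \<open>t\<close>.\<close>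

lemma convex_on_add_le_endpoints:
  fixes f :: "real \<Rightarrow> real"
  assumes f: "convex_on S f" and "a \<in> S" "b \<in> S"
    and "u + w = a + b" "a \<le> u" "u \<le> b"
  shows "f u + f w \<le> f a + f b"
proof (cases "a = b")
  case False
  then have "a < b" using assms by linarith
  define t where "t = (u - a) / (b - a)"
  have t: "0 \<le> t" "t \<le> 1" using \<open>a < b\<close> assms by (auto simp: t_def)
  have "t * (b - a) = u - a" using \<open>a < b\<close> by (simp add: t_def)
  then have u: "u = (1 - t) *\<^sub>R a + t *\<^sub>R b" and w: "w = (1 - t) *\<^sub>R b + t *\<^sub>R a"
    using assms by (simp_all add: algebra_simps)
  have "f u \<le> (1 - t) * f a + t * f b" "f w \<le> (1 - t) * f b + t * f a"
    unfolding u w by (intro convex_onD[OF f] t assms)+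
  then show ?thesis by (simp add: algebra_simps)
qed (use assms in auto)

text \<open>Expanding \<open>cosh (sqrt z)\<close> as a power series in \<open>z\<close> reduces this to the convexity of the
  powers on the nonnegative reals, applied to the squared norms.\<close>

lemma cosh_norm_parallelogram:
  fixes s y :: "'a::real_inner"
  assumes "0 \<le> k"
  shows "cosh (k * norm (s + y)) + cosh (k * norm (s - y))
    \<le> 2 * cosh (k * norm s) * cosh (k * norm y)"
proof -
  define a b where "a = k * norm s" and "b = k * norm y"
  \<comment> \<open>By the parallelogram law \<open>u + w = U + W\<close>, and Cauchy-Schwarz puts
    \<open>u\<close> between \<open>W\<close> and \<open>U\<close>: the endpoints are the squares
    that collinear vectors of the same norms would give.\<close>
  define U W u w where
    "U = (a + b)\<^sup>2" and "W = (a - b)\<^sup>2" and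
    "u = (k * norm (s + y))\<^sup>2" and "w = (k * norm (s - y))\<^sup>2"
  have uw: "u = k\<^sup>2 * ((norm s)\<^sup>2 + (norm y)\<^sup>2 + 2 * (s \<bullet> y))"
      "w = k\<^sup>2 * ((norm s)\<^sup>2 + (norm y)\<^sup>2 - 2 * (s \<bullet> y))"
    by (simp_all add: u_def w_def power2_norm_eq_inner inner_commute algebra_simps)
  have UW: "U = k\<^sup>2 * ((norm s)\<^sup>2 + (norm y)\<^sup>2 + 2 * (norm s * norm y))"
      "W = k\<^sup>2 * ((norm s)\<^sup>2 + (norm y)\<^sup>2 - 2 * (norm s * norm y))"
    by (simp_all add: U_def W_def a_def b_def power2_eq_square algebra_simps)
  have "\<bar>s \<bullet> y\<bar> \<le> norm s * norm y"
    by (rule Cauchy_Schwarz_ineq2)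
  then have "W \<le> u" "u \<le> U"
    unfolding uw UW by (intro mult_left_mono; simp; linarith)+
  then have pow: "u ^ m + w ^ m \<le> W ^ m + U ^ m" for m
    by (intro convex_on_add_le_endpoints[OF convex_on_power_nonneg])
      (auto simp: U_def W_def, simp add: uw UW algebra_simps flip: U_def W_def)
  have "cosh (k * norm (s + y)) + cosh (k * norm (s - y)) \<le> cosh (a - b) + cosh (a + b)"
  proof (rule sums_le)
    show "(\<lambda>m. u ^ m / fact (2 * m) + w ^ m / fact (2 * m)) sums
        (cosh (k * norm (s + y)) + cosh (k * norm (s - y)))"
      unfolding u_def w_def by (intro sums_add cosh_sums_even)
    show "(\<lambda>m. W ^ m / fact (2 * m) + U ^ m / fact (2 * m)) sums (cosh (a - b) + cosh (a + b))"
      unfolding U_def W_def by (intro sums_add cosh_sums_even)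
    show "u ^ m / fact (2 * m) + w ^ m / fact (2 * m)
        \<le> W ^ m / fact (2 * m) + U ^ m / fact (2 * m)" for m
      using pow[of m] by (simp add: divide_right_mono flip: add_divide_distrib)
  qed
  also have "\<dots> = 2 * cosh a * cosh b"
    by (simp add: cosh_add cosh_diff)
  finally show ?thesis by (simp add: a_def b_def)
qed

lemma exp_minus_half_le_cosh:
  fixes x :: real
  assumes "0 \<le> x"
  shows "exp (x - 1 / 2) \<le> cosh (sqrt 2 * x)"
proof (cases "x \<le> 1 / 2")
  case True
  then have "exp (x - 1 / 2) \<le> 1" by simp
  also have "\<dots> \<le> cosh (sqrt 2 * x)" by (rule cosh_real_ge_1)
  finally show ?thesis .
next
  case False
  \<comment> \<open>For \<open>x > 1 / 2\<close> the gain \<open>(sqrt 2 - 1) * x\<close> is at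
    least 0.4 / 2 = 0.2, while \<open>ln 2 - 1 / 2\<close> is at most 25/36 - 1/2 = 7/36 <
    0.2.\<close>
  have "1.4 \<le> sqrt (2::real)" by (rule real_le_rsqrt) (simp add: power2_eq_square)
  then have "1.4 * x \<le> sqrt 2 * x" using assms by (rule mult_right_mono)
  then have "x - 1 / 2 \<le> sqrt 2 * x - ln 2"
    using False ln2_le_25_over_36 by linarith
  then have "exp (x - 1 / 2) \<le> exp (sqrt 2 * x - ln 2)" by simp
  also have "\<dots> = exp (sqrt 2 * x) / 2" by (simp add: exp_diff)
  also have "\<dots> \<le> cosh (sqrt 2 * x)" by (simp add: cosh_field_def)
  finally show ?thesis .
qed

section \<open>From conditional laws to joint laws\<close>

text \<open>Pairing \<open>Y\<close> with the identity, seen as a map into \<open>F\<close>,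
  captures its dependence on all of \<open>F\<close>. On a rectangle \<open>A \<times> B\<close> the
  joint law is the integral over \<open>A\<close> of the conditional probability of
  \<open>B\<close>, hence the same for \<open>Y\<close> and \<open>Z\<close>; rectangles form a
  generating pi-system.\<close>

lemma cond_same_distr_nn_integral:
  fixes Y Z :: "'a \<Rightarrow> 'b::topological_space"
  assumes "finite_measure M" and sub: "subalgebra M F"
    and [measurable]: "Y \<in> borel_measurable M" "Z \<in> borel_measurable M"
    and YZ: "cond_same_distr M F Y Z"
    and [measurable]: "f \<in> borel_measurable (F \<Otimes>\<^sub>M borel)"
  shows "(\<integral>\<^sup>+ x. f (x, Y x) \<partial>M) = (\<integral>\<^sup>+ x. f (x, Z x) \<partial>M)"
proof -
  interpret finite_measure_subalgebra M F
    using assms(1) sub by (simp add: finite_measure_subalgebra_def finite_measure_subalgebra_axioms_def)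
  have space: "space F = space M" and sets: "A \<in> sets F \<Longrightarrow> A \<in> sets M" for A
    using sub by (auto simp: subalgebra_def)
  have [measurable]: "(\<lambda>x. x) \<in> measurable M F"
    using sub by (rule measurable_from_subalg) simp
  let ?D = "\<lambda>Y. distr M (F \<Otimes>\<^sub>M borel) (\<lambda>x. (x, Y x))"
  let ?E = "{A \<times> B | A B. A \<in> sets F \<and> B \<in> sets (borel :: 'b measure)}"
  have rect: "emeasure (?D Y) (A \<times> B) = ennreal (\<integral>x\<in>A. subalgebra_prob M F (Y -` B \<inter> space M) x \<partial>M)"
    if [measurable]: "Y \<in> borel_measurable M" and A: "A \<in> sets F" and B [measurable]: "B \<in> sets borel"
    for Y and A :: "'a set" and B :: "'b set"
  proof -
    have [measurable]: "A \<in> sets M" using A by (rule sets)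
    have "emeasure (?D Y) (A \<times> B) = emeasure M (A \<inter> (Y -` B \<inter> space M))"
      using A by (subst emeasure_distr) (auto intro!: arg_cong[where f = "emeasure M"])
    also have "\<dots> = ennreal (\<integral>x\<in>A. indicat_real (Y -` B \<inter> space M) x \<partial>M)"
      by (simp add: emeasure_eq_measure set_lebesgue_integral_def flip: indicator_inter_arith)
    also have "(\<integral>x\<in>A. indicat_real (Y -` B \<inter> space M) x \<partial>M)
        = (\<integral>x\<in>A. subalgebra_prob M F (Y -` B \<inter> space M) x \<partial>M)"
      unfolding subalgebra_prob_def using A by (intro real_cond_exp_intA integrable_real_indicator) (auto simp: less_top[symmetric])
    finally show ?thesis .
  qed
  have "?D Y = ?D Z"
  proof (rule measure_eqI_generator_eq[OF Int_stable_pair_measure_generator])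
    show "?E \<subseteq> Pow (space F \<times> UNIV)"
      using sets.space_closed[of F] by auto
    show "sets (?D Y) = sigma_sets (space F \<times> UNIV) ?E"
      "sets (?D Z) = sigma_sets (space F \<times> UNIV) ?E"
      by (simp_all add: sets_pair_measure)
    show "range (\<lambda>_::nat. space F \<times> UNIV) \<subseteq> ?E"
      by (intro image_subsetI CollectI exI[of _ "space F"] exI[of _ UNIV]) auto
    show "emeasure (?D Y) (space F \<times> UNIV) \<noteq> \<infinity>"
      by (subst emeasure_distr) auto
    fix P assume "P \<in> ?E"
    then obtain A B where P: "P = A \<times> B" and A: "A \<in> sets F" and B: "B \<in> sets borel" by auto
    have "AE x in M. subalgebra_prob M F (Y -` B \<inter> space M) x
        = subalgebra_prob M F (Z -` B \<inter> space M) x"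
      using YZ B by (simp add: cond_same_distr_def)
    then have "(\<integral>x\<in>A. subalgebra_prob M F (Y -` B \<inter> space M) x \<partial>M)
        = (\<integral>x\<in>A. subalgebra_prob M F (Z -` B \<inter> space M) x \<partial>M)"
      using sets[OF A] unfolding subalgebra_prob_def
      by (intro set_lebesgue_integral_cong_AE) auto
    then show "emeasure (?D Y) P = emeasure (?D Z) P"
      unfolding P using A B by (simp add: rect)
  qed auto
  then have "(\<integral>\<^sup>+ p. f p \<partial>?D Y) = (\<integral>\<^sup>+ p. f p \<partial>?D Z)" by simp
  then show ?thesis by (simp add: nn_integral_distr)
qed

section \<open>A maximal inequality for nonnegative supermartingales\<close>

text \<open>The induction bounds \<open>c\<close> times the probability of crossing the level \<open>c\<close> up to time \<open>n\<close> plus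
  the integral of \<open>Z n\<close> over the event of no crossing: the supermartingale stopped at the crossing.\<close>

lemma ville_maximal_inequality:
  fixes Z :: "nat \<Rightarrow> 'a \<Rightarrow> ennreal"
  assumes sub: "\<And>n. subalgebra M (F n)"
    and mono: "\<And>n. sets (F n) \<subseteq> sets (F (Suc n))"
    and Z: "\<And>n. Z n \<in> borel_measurable (F n)"
    and super: "\<And>n A. A \<in> sets (F n) \<Longrightarrow> (\<integral>\<^sup>+x\<in>A. Z (Suc n) x \<partial>M) \<le> (\<integral>\<^sup>+x\<in>A. Z n x \<partial>M)"
  shows "c * emeasure M {x \<in> space M. \<exists>n. c \<le> Z n x} \<le> (\<integral>\<^sup>+x. Z 0 x \<partial>M)"
proof -
  have space: "space (F n) = space M" and sets: "A \<in> sets (F n) \<Longrightarrow> A \<in> sets M" for n A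
    using sub by (auto simp: subalgebra_def)
  have ZM [measurable]: "Z n \<in> borel_measurable M" for n
    using sub Z by (rule measurable_from_subalg)
  define B where "B n = {x \<in> space M. \<exists>m\<le>n. c \<le> Z m x}" for n
  have F_mono: "sets (F m) \<subseteq> sets (F n)" if "m \<le> n" for m n
    using mono that by (rule lift_Suc_mono_le)
  have B_sets: "B n \<in> sets (F n)" for n
  proof -
    have "B n = (\<Union>m\<in>{..n}. {x \<in> space (F m). c \<le> Z m x})"
      by (auto simp: B_def space)
    also have "\<dots> \<in> sets (F n)"
    proof (intro sets.finite_UN finite_atMost)
      fix m assume "m \<in> {..n}"
      moreover have "{x \<in> space (F m). c \<le> Z m x} \<in> sets (F m)"
        using Z by measurable
      ultimately show "{x \<in> space (F m). c \<le> Z m x} \<in> sets (F n)"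
        using F_mono by auto
    qed
    finally show ?thesis .
  qed
  have [measurable]: "B n \<in> sets M" for n
    using B_sets by (rule sets)
  have bound: "c * emeasure M (B n) + (\<integral>\<^sup>+x\<in>space M - B n. Z n x \<partial>M) \<le> (\<integral>\<^sup>+x. Z 0 x \<partial>M)" for n
  proof (induction n)
    case 0
    have "c * emeasure M (B 0) + (\<integral>\<^sup>+x\<in>space M - B 0. Z 0 x \<partial>M)
        = (\<integral>\<^sup>+x. c * indicator (B 0) x + Z 0 x * indicator (space M - B 0) x \<partial>M)"
      by (subst nn_integral_add) (auto simp: nn_integral_cmult)
    also have "\<dots> \<le> (\<integral>\<^sup>+x. Z 0 x \<partial>M)"
      by (intro nn_integral_mono) (auto simp: B_def split: split_indicator)
    finally show ?case .
  next
    case (Suc n)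
    let ?C = "B (Suc n) - B n"
    have split: "emeasure M (B (Suc n)) = emeasure M (B n) + emeasure M ?C"
    proof -
      have "B n \<union> ?C = B (Suc n)" by (auto simp: B_def le_Suc_eq)
      moreover have "emeasure M (B n) + emeasure M ?C = emeasure M (B n \<union> ?C)"
        by (rule plus_emeasure) auto
      ultimately show ?thesis by simp
    qed
    \<comment> \<open>On \<open>?C\<close> the level is first reached at time \<open>Suc n\<close>,
      so \<open>c \<le> Z (Suc n) x\<close> there and the new crossings are paid for by the integral
      of \<open>Z (Suc n)\<close>.\<close>
    have "c * emeasure M ?C + (\<integral>\<^sup>+x\<in>space M - B (Suc n). Z (Suc n) x \<partial>M)
        = (\<integral>\<^sup>+x. c * indicator ?C x + Z (Suc n) x * indicator (space M - B (Suc n)) x \<partial>M)"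
      by (subst nn_integral_add) (auto simp: nn_integral_cmult)
    also have "\<dots> \<le> (\<integral>\<^sup>+x\<in>space M - B n. Z (Suc n) x \<partial>M)"
      by (intro nn_integral_mono) (auto simp: B_def le_Suc_eq split: split_indicator)
    \<comment> \<open>Not having crossed up to time \<open>n\<close> is an event of
      \<open>F n\<close>, so the supermartingale property applies on it.\<close>
    also have "\<dots> \<le> (\<integral>\<^sup>+x\<in>space M - B n. Z n x \<partial>M)"
      using sets.compl_sets[OF B_sets[of n]] by (intro super) (simp add: space)
    finally have "c * emeasure M (B n)
          + (c * emeasure M ?C + (\<integral>\<^sup>+x\<in>space M - B (Suc n). Z (Suc n) x \<partial>M))
        \<le> c * emeasure M (B n) + (\<integral>\<^sup>+x\<in>space M - B n. Z n x \<partial>M)"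
      by (rule add_left_mono)
    also note Suc
    finally show ?case by (simp add: split distrib_left add.assoc)
  qed
  have "{x \<in> space M. \<exists>n. c \<le> Z n x} = (\<Union>n. B n)"
    by (auto simp: B_def)
  also have "c * emeasure M \<dots> = (SUP n. c * emeasure M (B n))"
  proof (subst SUP_emeasure_incseq[symmetric])
    show "incseq B" by (auto simp: B_def incseq_def intro: order_trans)
  qed (auto simp: SUP_mult_left_ennreal)
  also have "\<dots> \<le> (\<integral>\<^sup>+x. Z 0 x \<partial>M)"
  proof (rule SUP_least)
    fix n
    have "c * emeasure M (B n) \<le> c * emeasure M (B n) + (\<integral>\<^sup>+x\<in>space M - B n. Z n x \<partial>M)"
      by simp
    also note bound
    finally show "c * emeasure M (B n) \<le> (\<integral>\<^sup>+x. Z 0 x \<partial>M)" .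
  qed
  finally show ?thesis .
qed

section \<open>One step of the \<open>cosh\<close> supermartingale\<close>

lemma borel_measurable_cosh [measurable]: "cosh \<in> borel_measurable (borel :: real measure)"
  by (intro borel_measurable_continuous_onI continuous_intros)

text \<open>Since \<open>S\<close>, \<open>l\<close>, \<open>C\<close> and \<open>A\<close> are
  known to \<open>F\<close>, replacing \<open>Y\<close> by \<open>- Y\<close> leaves the left-hand
  integral unchanged. Twice that integral is therefore the integral of a symmetrised integrand,
  which is bounded pointwise.\<close>

lemma cosh_norm_supermartingale_step:
  fixes Y S :: "'a \<Rightarrow> 'b::euclidean_space" and l C :: "'a \<Rightarrow> real"
  assumes "finite_measure M" and sub: "subalgebra M F"
    and YM [measurable]: "Y \<in> borel_measurable M"
    and sym: "cond_same_distr M F Y (\<lambda>x. - Y x)"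
    and [measurable]: "S \<in> borel_measurable F" "l \<in> borel_measurable F" "C \<in> borel_measurable F"
    and A [measurable]: "A \<in> sets F"
  shows "(\<integral>\<^sup>+x\<in>A. ennreal (cosh (sqrt 2 * norm (S x + l x *\<^sub>R Y x))
            * exp (- (C x + (l x)\<^sup>2 * (norm (Y x))\<^sup>2))) \<partial>M)
    \<le> (\<integral>\<^sup>+x\<in>A. ennreal (cosh (sqrt 2 * norm (S x)) * exp (- C x)) \<partial>M)"
proof -
  have [measurable]: "(\<lambda>x. x) \<in> measurable M F"
    using sub by (rule measurable_from_subalg) simp
  define g where "g x y = cosh (sqrt 2 * norm (S x + l x *\<^sub>R y))
    * exp (- (C x + (l x)\<^sup>2 * (norm y)\<^sup>2))" for x y
  define f where "f p = ennreal (g (fst p) (snd p)) * indicator A (fst p)" for p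
  define h where "h x = ennreal (cosh (sqrt 2 * norm (S x)) * exp (- C x)) * indicator A x" for x
  have f [measurable]: "f \<in> borel_measurable (F \<Otimes>\<^sub>M borel)"
    unfolding f_def g_def by measurable
  have h [measurable]: "h \<in> borel_measurable M"
    by (rule measurable_from_subalg[OF sub]) (unfold h_def, measurable)
  have g0: "0 \<le> g x y" for x y
    by (simp add: g_def)
  \<comment> \<open>The factor \<open>sqrt 2\<close> is chosen so that
    \<open>(sqrt 2 * norm z)\<^sup>2 / 2\<close> is exactly the squared norm of the increment; the
    resulting exponential then cancels the increment of the compensator \<open>C\<close>.\<close>
  have g_sym: "g x y + g x (- y) \<le> 2 * (cosh (sqrt 2 * norm (S x)) * exp (- C x))" for x y
  proof -
    let ?z = "l x *\<^sub>R y" and ?s = "cosh (sqrt 2 * norm (S x))"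
    have "cosh (sqrt 2 * norm ?z) \<le> exp ((sqrt 2 * norm ?z)\<^sup>2 / 2)"
      by (rule cosh_le_exp_half_square)
    also have "(sqrt 2 * norm ?z)\<^sup>2 / 2 = (l x)\<^sup>2 * (norm y)\<^sup>2"
      by (simp add: power_mult_distrib)
    finally have "2 * ?s * cosh (sqrt 2 * norm ?z) \<le> 2 * ?s * exp ((l x)\<^sup>2 * (norm y)\<^sup>2)"
      by (intro mult_left_mono) auto
    with cosh_norm_parallelogram[of "sqrt 2" "S x" ?z, OF real_sqrt_ge_zero]
    have "cosh (sqrt 2 * norm (S x + ?z)) + cosh (sqrt 2 * norm (S x - ?z))
        \<le> 2 * ?s * exp ((l x)\<^sup>2 * (norm y)\<^sup>2)" by linarith
    then have "(cosh (sqrt 2 * norm (S x + ?z)) + cosh (sqrt 2 * norm (S x - ?z)))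
          * exp (- (C x + (l x)\<^sup>2 * (norm y)\<^sup>2))
        \<le> 2 * ?s * exp ((l x)\<^sup>2 * (norm y)\<^sup>2) * exp (- (C x + (l x)\<^sup>2 * (norm y)\<^sup>2))"
      by (rule mult_right_mono) simp
    also have "\<dots> = 2 * (?s * exp (- C x))"
      by (simp flip: exp_add)
    finally show ?thesis
      by (simp add: g_def distrib_right)
  qed
  have "2 * (\<integral>\<^sup>+x. f (x, Y x) \<partial>M) = (\<integral>\<^sup>+x. f (x, Y x) \<partial>M) + (\<integral>\<^sup>+x. f (x, - Y x) \<partial>M)"
    using cond_same_distr_nn_integral[OF assms(1) sub YM _ sym f]
    by (simp add: mult_2)
  also have "\<dots> = (\<integral>\<^sup>+x. f (x, Y x) + f (x, - Y x) \<partial>M)"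
    by (rule nn_integral_add[symmetric]) measurable
  also have "\<dots> \<le> (\<integral>\<^sup>+x. 2 * h x \<partial>M)"
  proof (rule nn_integral_mono)
    fix x
    have "ennreal (g x (Y x)) + ennreal (g x (- Y x))
        \<le> ennreal (2 * (cosh (sqrt 2 * norm (S x)) * exp (- C x)))"
      using g_sym[of x "Y x"] by (simp add: g0 ennreal_leI flip: ennreal_plus)
    then show "f (x, Y x) + f (x, - Y x) \<le> 2 * h x"
      by (simp add: f_def h_def ennreal_mult' split: split_indicator)
  qed
  also have "\<dots> = 2 * (\<integral>\<^sup>+x. h x \<partial>M)"
    by (rule nn_integral_cmult) measurable
  finally have "(\<integral>\<^sup>+x. f (x, Y x) \<partial>M) \<le> (\<integral>\<^sup>+x. h x \<partial>M)"
    by (simp add: ennreal_mult_le_mult_iff)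
  then show ?thesis
    by (simp add: f_def g_def h_def)
qed

section \<open>The norm of the mean\<close>

text \<open>Integrating the conditional moments gives mean \<open>\<mu>\<close> and second moment at
  most \<open>v\<^sup>2\<close>; the expectation of
  \<open>0 \<le> (norm (\<mu> - X x))\<^sup>2\<close> then yields the claim, an instance of Jensen's
  inequality.\<close>

lemma norm_le_of_vec_cond_exp:
  fixes X :: "'a \<Rightarrow> real ^ 'd"
  assumes "prob_space M" and sub: "subalgebra M F" and "0 \<le> v"
    and XM [measurable]: "X \<in> borel_measurable M"
    and mean: "AE x in M. vec_cond_exp M F X x = \<mu>"
    and second: "AE x in M. nn_cond_exp M F (\<lambda>x. ennreal ((norm (X x))\<^sup>2)) x \<le> ennreal (v\<^sup>2)"
  shows "norm \<mu> \<le> v"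
proof -
  interpret prob_space M by fact
  interpret finite_measure_subalgebra M F
    using sub by unfold_locales
  have "(\<integral>\<^sup>+x. ennreal ((norm (X x))\<^sup>2) \<partial>M)
      = (\<integral>\<^sup>+x. nn_cond_exp M F (\<lambda>x. ennreal ((norm (X x))\<^sup>2)) x \<partial>M)"
    using nn_cond_exp_intg[of "\<lambda>_. 1" "\<lambda>x. ennreal ((norm (X x))\<^sup>2)"] by simp
  also have "\<dots> \<le> (\<integral>\<^sup>+x. ennreal (v\<^sup>2) \<partial>M)"
    using second by (rule nn_integral_mono_AE)
  finally have nn: "(\<integral>\<^sup>+x. ennreal ((norm (X x))\<^sup>2) \<partial>M) \<le> ennreal (v\<^sup>2)"
    by (simp add: emeasure_space_1)
  have int2: "integrable M (\<lambda>x. (norm (X x))\<^sup>2)"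
    using nn by (intro integrableI_nonneg) (auto simp: le_less_trans)
  have second_le: "(\<integral>x. (norm (X x))\<^sup>2 \<partial>M) \<le> v\<^sup>2"
    using nn by (intro integral_real_bounded) auto
  have meas [measurable]: "(\<lambda>x. X x $ j) \<in> borel_measurable M" for j
    by (rule measurable_compose[OF XM])
      (intro borel_measurable_continuous_onI continuous_on_component continuous_on_id)
  \<comment> \<open>Integrability of the coordinates, from \<open>r \<le> 1 + r\<^sup>2\<close>, is
    what gives \<open>real_cond_exp\<close> its meaning and lets it preserve the mean.\<close>
  have intX: "integrable M (\<lambda>x. X x $ j)" for j
  proof (rule Bochner_Integration.integrable_bound)
    show "integrable M (\<lambda>x. 1 + (norm (X x))\<^sup>2)" using int2 by simp
    have "\<bar>X x $ j\<bar> \<le> 1 + (norm (X x))\<^sup>2" for x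
    proof -
      have "\<bar>X x $ j\<bar> \<le> norm (X x)" by (rule component_le_norm_cart)
      moreover have "0 \<le> (norm (X x) - 1)\<^sup>2" by simp
      then have "2 * norm (X x) \<le> 1 + (norm (X x))\<^sup>2" by (simp add: power2_diff)
      ultimately show ?thesis by (smt (verit) norm_ge_zero)
    qed
    then show "AE x in M. norm (X x $ j) \<le> norm (1 + (norm (X x))\<^sup>2)"
      by simp
  qed (rule meas)
  have mean_comp: "(\<integral>x. X x $ j \<partial>M) = \<mu> $ j" for j
  proof -
    have "(\<integral>x. X x $ j \<partial>M) = (\<integral>x. real_cond_exp M F (\<lambda>x. X x $ j) x \<partial>M)"
      using real_cond_exp_int(2)[OF intX] by simp
    also have "\<dots> = (\<integral>x. \<mu> $ j \<partial>M)"
      using mean by (intro integral_cong_AE) (auto simp: vec_cond_exp_def vec_eq_iff)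
    finally show ?thesis by (simp add: prob_space)
  qed
  have "2 * (norm \<mu>)\<^sup>2 = 2 * (\<Sum>j\<in>UNIV. \<mu> $ j * (\<integral>x. X x $ j \<partial>M))"
    by (simp add: mean_comp power2_norm_eq_inner inner_vec_def)
  also have "\<dots> = (\<integral>x. 2 * (\<mu> \<bullet> X x) \<partial>M)"
    by (simp add: inner_vec_def intX Bochner_Integration.integral_sum)
  also have "\<dots> \<le> (\<integral>x. (norm \<mu>)\<^sup>2 + (norm (X x))\<^sup>2 \<partial>M)"
  proof (rule integral_mono)
    show "integrable M (\<lambda>x. 2 * (\<mu> \<bullet> X x))" by (simp add: inner_vec_def intX)
    show "integrable M (\<lambda>x. (norm \<mu>)\<^sup>2 + (norm (X x))\<^sup>2)" using int2 by simp
    fix x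
    have "0 \<le> (norm (\<mu> - X x))\<^sup>2" by simp
    then show "2 * (\<mu> \<bullet> X x) \<le> (norm \<mu>)\<^sup>2 + (norm (X x))\<^sup>2"
      unfolding power2_norm_eq_inner by (simp add: inner_diff inner_commute)
  qed
  also have "\<dots> \<le> (norm \<mu>)\<^sup>2 + v\<^sup>2"
    using int2 second_le by (simp add: prob_space)
  finally have "(norm \<mu>)\<^sup>2 \<le> v\<^sup>2" by simp
  then show ?thesis using \<open>0 \<le> v\<close> by (rule power2_le_imp_le)
qed

section \<open>The natural filtration\<close>

lemma space_natural_filtration [simp]: "space (natural_filtration M X t) = space M"
  unfolding natural_filtration_def by (rule space_measure_of) auto

lemma sets_natural_filtration:
  "sets (natural_filtration M X t)
    = sigma_sets (space M) (\<Union>i\<in>{1..t}. {X i -` A \<inter> space M | A. A \<in> sets borel})"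
  unfolding natural_filtration_def by (rule sets_measure_of) auto

lemma subalgebra_natural_filtration:
  assumes "\<And>i. 1 \<le> i \<Longrightarrow> i \<le> t \<Longrightarrow> X i \<in> borel_measurable M"
  shows "subalgebra M (natural_filtration M X t)"
proof -
  have "(\<Union>i\<in>{1..t}. {X i -` A \<inter> space M | A. A \<in> sets borel}) \<subseteq> sets M"
    using assms by (auto intro: measurable_sets)
  then show ?thesis
    by (simp add: subalgebra_def sets_natural_filtration sets.sigma_sets_subset)
qed

lemma sets_natural_filtration_mono:
  "s \<le> t \<Longrightarrow> sets (natural_filtration M X s) \<subseteq> sets (natural_filtration M X t)"
  unfolding sets_natural_filtration by (intro sigma_sets_mono' UN_mono) auto

lemma measurable_natural_filtration:
  assumes "1 \<le> i" "i \<le> t"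
  shows "X i \<in> borel_measurable (natural_filtration M X t)"
proof (rule measurableI)
  fix A :: "'b set" assume "A \<in> sets borel"
  then show "X i -` A \<inter> space (natural_filtration M X t) \<in> sets (natural_filtration M X t)"
    unfolding sets_natural_filtration space_natural_filtration
    using assms by (intro sigma_sets.Basic UN_I[of i]) auto
qed simp

section \<open>The time-uniform confidence bound\<close>

theorem theorem3p5:
  fixes M :: "'a measure"
    and X :: "nat \<Rightarrow> 'a \<Rightarrow> real ^ 'd"
    and \<Lambda> :: "nat \<Rightarrow> 'a \<Rightarrow> real"
    and \<mu> :: "real ^ 'd"
    and v \<alpha> :: real
  assumes "prob_space M"
    and "v > 0"
    and "\<And>t. t \<ge> 1 \<Longrightarrow> X t \<in> borel_measurable M"
    and "\<And>t. t \<ge> 1 \<Longrightarrow>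
           AE \<omega> in M. vec_cond_exp M (natural_filtration M X (t - 1)) (X t) \<omega> = \<mu>"
    and "\<And>t. t \<ge> 1 \<Longrightarrow>
           AE \<omega> in M. nn_cond_exp M (natural_filtration M X (t - 1))
                        (\<lambda>x. ennreal ((norm (X t x))\<^sup>2)) \<omega> \<le> ennreal (v\<^sup>2)"
    and "\<And>t. t \<ge> 1 \<Longrightarrow>
           cond_same_distr M (natural_filtration M X (t - 1))
             (\<lambda>\<omega>. X t \<omega> - \<mu>) (\<lambda>\<omega>. - (X t \<omega> - \<mu>))"
    and "predictable (natural_filtration M X) \<Lambda>"
    and "\<And>t. t \<ge> 1 \<Longrightarrow> AE \<omega> in M. \<Lambda> t \<omega> > 0"
    and "0 < \<alpha>" and "\<alpha> < 1"
  shows "measure M {\<omega> \<in> space M. \<forall>t\<ge>1.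
           norm ((\<Sum>i=1..t. \<Lambda> i \<omega> *\<^sub>R X i \<omega>) /\<^sub>R (\<Sum>i=1..t. \<Lambda> i \<omega>) - \<mu>)
             \<le> ((\<Sum>i=1..t. (\<Lambda> i \<omega>)\<^sup>2 * (norm (X i \<omega>) + v)\<^sup>2) + 1 / 2 + ln (1 / \<alpha>))
                / (\<Sum>i=1..t. \<Lambda> i \<omega>)} \<ge> 1 - \<alpha>"
proof -
  interpret prob_space M by fact
  note v = assms(2) and X = assms(3) and mean = assms(4) and second = assms(5)
    and sym = assms(6) and pred = assms(7) and pos = assms(8)
  have fin: "finite_measure M" by unfold_locales
  let ?F = "natural_filtration M X"
  \<comment> \<open>At \<open>n = 0\<close> both sums are empty, so \<open>Z 0\<close> is constantly
    1.\<close>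
  define S where "S n \<omega> = (\<Sum>i=1..n. \<Lambda> i \<omega> *\<^sub>R (X i \<omega> - \<mu>))" for n \<omega>
  define C where "C n \<omega> = (\<Sum>i=1..n. (\<Lambda> i \<omega>)\<^sup>2 * (norm (X i \<omega> - \<mu>))\<^sup>2)" for n \<omega>
  define Z where "Z n \<omega> = ennreal (cosh (sqrt 2 * norm (S n \<omega>)) * exp (- C n \<omega>))" for n \<omega>
  have sub: "subalgebra M (?F n)" for n
    using X by (rule subalgebra_natural_filtration)
  \<comment> \<open>Predictability reaches one index further than adaptedness:
    \<open>\<Lambda> (Suc n)\<close> is already measurable at time \<open>n\<close>, as the
    supermartingale step requires.\<close>
  have \<Lambda>F: "\<Lambda> i \<in> borel_measurable (?F n)" if "1 \<le> i" "i \<le> Suc n" for i n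
  proof (rule measurable_from_subalg)
    show "subalgebra (?F n) (?F (i - 1))"
      using sets_natural_filtration_mono[of "i - 1" n M X] that by (simp add: subalgebra_def)
    show "\<Lambda> i \<in> borel_measurable (?F (i - 1))"
      using pred that by (simp add: predictable_def)
  qed
  have \<Lambda>M: "\<Lambda> i \<in> borel_measurable M" if "1 \<le> i" for i
    using sub \<Lambda>F[of i i] that by (intro measurable_from_subalg[of M "?F i"]) auto
  have SF: "S n \<in> borel_measurable (?F n)" and CF: "C n \<in> borel_measurable (?F n)" for n
  proof -
    have [measurable]: "X i \<in> borel_measurable (?F n)" "\<Lambda> i \<in> borel_measurable (?F n)"
      if "i \<in> {1..n}" for i
      using that by (auto intro: measurable_natural_filtration \<Lambda>F)
    show "S n \<in> borel_measurable (?F n)" "C n \<in> borel_measurable (?F n)"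
      unfolding S_def C_def by measurable
  qed
  have "ennreal (1 / \<alpha>) * emeasure M {\<omega> \<in> space M. \<exists>n. ennreal (1 / \<alpha>) \<le> Z n \<omega>}
      \<le> (\<integral>\<^sup>+\<omega>. Z 0 \<omega> \<partial>M)"
  proof (rule ville_maximal_inequality[OF sub])
    show "sets (?F n) \<subseteq> sets (?F (Suc n))" for n
      by (rule sets_natural_filtration_mono) simp
    show "Z n \<in> borel_measurable (?F n)" for n
      using SF[of n, measurable] CF[of n, measurable] unfolding Z_def by measurable
    fix n A assume "A \<in> sets (?F n)"
    moreover have "cond_same_distr M (?F n) (\<lambda>\<omega>. X (Suc n) \<omega> - \<mu>) (\<lambda>\<omega>. - (X (Suc n) \<omega> - \<mu>))"
      using sym[of "Suc n"] by simp
    moreover have "(\<lambda>\<omega>. X (Suc n) \<omega> - \<mu>) \<in> borel_measurable M"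
      using X[of "Suc n"] by simp
    ultimately show "(\<integral>\<^sup>+\<omega>\<in>A. Z (Suc n) \<omega> \<partial>M) \<le> (\<integral>\<^sup>+\<omega>\<in>A. Z n \<omega> \<partial>M)"
      using cosh_norm_supermartingale_step[OF fin sub _ _ SF \<Lambda>F[of "Suc n" n] CF]
      by (simp add: Z_def S_def C_def)
  qed
  then have ville: "ennreal (1 / \<alpha>) * emeasure M {\<omega> \<in> space M. \<exists>n. ennreal (1 / \<alpha>) \<le> Z n \<omega>} \<le> 1"
    by (simp add: Z_def S_def C_def emeasure_space_1)
  \<comment> \<open>The exceptional event: some \<open>Z n\<close> reaches
    \<open>1 / \<alpha>\<close>, which has probability at most \<open>\<alpha>\<close>.\<close>
  define B where "B = {\<omega> \<in> space M. \<exists>n. ennreal (1 / \<alpha>) \<le> Z n \<omega>}"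
  have [measurable]: "Z n \<in> borel_measurable M" for n
    using measurable_from_subalg[OF sub SF[of n], measurable]
      measurable_from_subalg[OF sub CF[of n], measurable] unfolding Z_def by measurable
  have [measurable]: "B \<in> sets M"
    unfolding B_def by measurable
  have "ennreal (1 / \<alpha> * prob B) \<le> ennreal 1"
    using ville \<open>0 < \<alpha>\<close> unfolding B_def[symmetric] emeasure_eq_measure
    by (subst ennreal_mult) auto
  then have "prob B \<le> \<alpha>"
    using \<open>0 < \<alpha>\<close> by (simp add: field_simps)
  let ?G = "{\<omega> \<in> space M. \<forall>t\<ge>1.
           norm ((\<Sum>i=1..t. \<Lambda> i \<omega> *\<^sub>R X i \<omega>) /\<^sub>R (\<Sum>i=1..t. \<Lambda> i \<omega>) - \<mu>)
             \<le> ((\<Sum>i=1..t. (\<Lambda> i \<omega>)\<^sup>2 * (norm (X i \<omega>) + v)\<^sup>2) + 1 / 2 + ln (1 / \<alpha>))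
                / (\<Sum>i=1..t. \<Lambda> i \<omega>)}"
  have sums: "(\<lambda>\<omega>. \<Sum>i=1..t. \<Lambda> i \<omega> *\<^sub>R X i \<omega>) \<in> borel_measurable M"
    "(\<lambda>\<omega>. \<Sum>i=1..t. \<Lambda> i \<omega>) \<in> borel_measurable M"
    "(\<lambda>\<omega>. \<Sum>i=1..t. (\<Lambda> i \<omega>)\<^sup>2 * (norm (X i \<omega>) + v)\<^sup>2) \<in> borel_measurable M" for t
  proof -
    have [measurable]: "X i \<in> borel_measurable M" "\<Lambda> i \<in> borel_measurable M" if "i \<in> {1..t}" for i
      using that X \<Lambda>M by auto
    show "(\<lambda>\<omega>. \<Sum>i=1..t. \<Lambda> i \<omega> *\<^sub>R X i \<omega>) \<in> borel_measurable M"
      "(\<lambda>\<omega>. \<Sum>i=1..t. \<Lambda> i \<omega>) \<in> borel_measurable M"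
      "(\<lambda>\<omega>. \<Sum>i=1..t. (\<Lambda> i \<omega>)\<^sup>2 * (norm (X i \<omega>) + v)\<^sup>2) \<in> borel_measurable M"
      by measurable
  qed
  have G: "?G \<in> sets M"
    by (intro sets.sets_Collect_countable_All sets.sets_Collect_imp sets.sets_Collect_const
        borel_measurable_le measurable_compose[OF _ borel_measurable_norm] borel_measurable_diff
        borel_measurable_divide borel_measurable_add borel_measurable_scaleR
        borel_measurable_inverse borel_measurable_const sums)
  have \<mu>v: "norm \<mu> \<le> v"
    using v X[of 1] mean[of 1] second[of 1]
    by (intro norm_le_of_vec_cond_exp[OF \<open>prob_space M\<close> sub[of 0], of _ "X 1"]) simp_all
  \<comment> \<open>Each weight is only almost surely positive; the countably many null sets are
    merged into one, so that all the sums divided by are positive at once.\<close>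
  have "AE \<omega> in M. \<forall>t. 1 \<le> t \<longrightarrow> 0 < \<Lambda> t \<omega>"
    unfolding AE_all_countable
  proof
    show "AE \<omega> in M. 1 \<le> t \<longrightarrow> 0 < \<Lambda> t \<omega>" for t
      using pos[of t] by (cases "1 \<le> t") simp_all
  qed
  then have "AE \<omega> in M. \<omega> \<in> space M - B \<longrightarrow> \<omega> \<in> ?G"
  proof (rule AE_mp, intro AE_I2 impI)
    fix \<omega> assume \<omega>: "\<omega> \<in> space M" and \<Lambda>: "\<forall>t. 1 \<le> t \<longrightarrow> 0 < \<Lambda> t \<omega>" and nB: "\<omega> \<in> space M - B"
    have "norm ((\<Sum>i=1..t. \<Lambda> i \<omega> *\<^sub>R X i \<omega>) /\<^sub>R (\<Sum>i=1..t. \<Lambda> i \<omega>) - \<mu>)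
             \<le> ((\<Sum>i=1..t. (\<Lambda> i \<omega>)\<^sup>2 * (norm (X i \<omega>) + v)\<^sup>2) + 1 / 2 + ln (1 / \<alpha>))
                / (\<Sum>i=1..t. \<Lambda> i \<omega>)" if "1 \<le> t" for t
    proof -
      define L where "L = (\<Sum>i=1..t. \<Lambda> i \<omega>)"
      have "0 < L"
        unfolding L_def using \<Lambda> that by (intro sum_pos) auto
      have "Z t \<omega> < ennreal (1 / \<alpha>)"
        using nB by (auto simp: B_def not_le)
      then have "cosh (sqrt 2 * norm (S t \<omega>)) * exp (- C t \<omega>) < 1 / \<alpha>"
        using \<open>0 < \<alpha>\<close> by (simp add: Z_def ennreal_less_iff)
      \<comment> \<open>Passing from \<open>cosh\<close> to an exponential makes the bound on
        \<open>Z t\<close> linear in \<open>norm (S t \<omega>)\<close> after taking logarithms;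
        this is the source of the summand 1/2.\<close>
      moreover have "exp (norm (S t \<omega>) - 1 / 2) * exp (- C t \<omega>)
          \<le> cosh (sqrt 2 * norm (S t \<omega>)) * exp (- C t \<omega>)"
        by (intro mult_right_mono exp_minus_half_le_cosh) auto
      ultimately have "exp (norm (S t \<omega>) - 1 / 2 - C t \<omega>) < 1 / \<alpha>"
        by (simp flip: exp_add)
      then have "norm (S t \<omega>) - 1 / 2 - C t \<omega> < ln (1 / \<alpha>)"
        using \<open>0 < \<alpha>\<close> by (subst exp_less_cancel_iff[symmetric]) simp
      moreover have "C t \<omega> \<le> (\<Sum>i=1..t. (\<Lambda> i \<omega>)\<^sup>2 * (norm (X i \<omega>) + v)\<^sup>2)"
        unfolding C_def
      proof (intro sum_mono mult_left_mono power_mono)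
        show "norm (X i \<omega> - \<mu>) \<le> norm (X i \<omega>) + v" for i
          using norm_triangle_ineq4[of "X i \<omega>" \<mu>] \<mu>v by linarith
      qed auto
      ultimately have S_le: "norm (S t \<omega>)
          \<le> (\<Sum>i=1..t. (\<Lambda> i \<omega>)\<^sup>2 * (norm (X i \<omega>) + v)\<^sup>2) + 1 / 2 + ln (1 / \<alpha>)"
        by linarith
      \<comment> \<open>The error of the weighted mean is the centred sum
        \<open>S t \<omega>\<close> divided by the total weight \<open>L\<close>.\<close>
      have "S t \<omega> = (\<Sum>i=1..t. \<Lambda> i \<omega> *\<^sub>R X i \<omega>) - L *\<^sub>R \<mu>"
        by (simp add: S_def L_def scaleR_diff_right sum_subtractf scaleR_sum_left)
      then have "(\<Sum>i=1..t. \<Lambda> i \<omega> *\<^sub>R X i \<omega>) /\<^sub>R L - \<mu> = S t \<omega> /\<^sub>R L"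
        using \<open>0 < L\<close> by (simp add: scaleR_diff_right)
      then have "norm ((\<Sum>i=1..t. \<Lambda> i \<omega> *\<^sub>R X i \<omega>) /\<^sub>R L - \<mu>) = norm (S t \<omega>) / L"
        using \<open>0 < L\<close> by (simp add: divide_inverse_commute)
      then show ?thesis
        unfolding L_def[symmetric] using S_le \<open>0 < L\<close> by (simp add: divide_right_mono)
    qed
    then show "\<omega> \<in> ?G"
      using \<omega> unfolding mem_Collect_eq by (intro conjI allI impI)
  qed
  then have "prob (space M - B) \<le> prob ?G"
    by (rule finite_measure_mono_AE) (rule G)
  moreover have "prob (space M - B) = 1 - prob B"
    by (rule prob_compl) measurable
  ultimately show ?thesis
    using \<open>prob B \<le> \<alpha>\<close> by linarith
qed

end
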